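(* Let $\mathcal A=\mathbb C[z,z^{-1}]$ be the space of Laurent polynomials $f[z]$, and let $q\in\mathbb C$ be nonzero with $q^m\neq1$ for all $m=1,2,\dots$. For $a\in\mathbb C$ define operators on $\mathcal A$ by $$(T_0 f)[z]:=-\frac{z}{q-z^2}\left(f[z]-f[q z^{-1}]\right),\qquad (T_1 f)[z]:=\frac{az-1}{1-z^2}\left(f[z]-f[z^{-1}]\right),\qquad (Xf)[z]:=zf[z].$$ (i) If $a\neq 0$, these formulas define a faithful representation of the algebra $\mathcal H_{\rm III}^{D_7}$ on $\mathcal A$. (ii) If $a=0$, these formulas define a faithful representation of the algebra $\mathcal H_{\rm III}^{D_8}$ on $\mathcal A$. Here "define a faithful representation" means that the operators map $\mathcal A$ to itself, extend to an algebra homomorphism from the given algebra to $\mathrm{End}_{\mathbb C}(\mathcal A)$ (with $X^{-1}$ acting as multiplication by $z^{-1}$), and that this homomorphism is injective.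
   Context: $\mathcal H_{\rm III}^{D_7}$ is the unital associative $\mathbb C$-algebra (depending on parameters $q,a$) generated by $T_0,T_1,X^{\pm1}$ (with $XX^{-1}=X^{-1}X=1$) with defining relations $$T_1(T_1+1)=0,\qquad T_0^2=0,\qquad T_1X+a-X^{-1}(T_1+1)=0,\qquad qT_0X^{-1}+1-XT_0=0.$$ $\mathcal H_{\rm III}^{D_8}$ is the unital associative $\mathbb C$-algebra (depending on the parameter $q$) generated by $T_0,T_1,X^{\pm1}$ (with $XX^{-1}=X^{-1}X=1$) with defining relations $$T_1(T_1+1)=0,\qquad T_0^2=0,\qquad T_1X-X^{-1}(T_1+1)=0,\qquad qT_0X^{-1}+1-XT_0=0.$$ *)

theory Defs
  imports
    Complex_Main
    "HOL-Library.Poly_Mapping"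
    "HOL-Computational_Algebra.Fraction_Field"
    "HOL-Algebra.QuotRing"
    "HOL-Algebra.Module"
begin

section \<open>Unital associative complex algebras\<close>

text \<open>
  An associative unital \<open>\<complex>\<close>-algebra is represented by the record type of
  \<^theory>\<open>HOL-Algebra.Module\<close>: a ring record extended by a scalar multiplication.
  (The locale \<^locale>\<open>algebra\<close> is not used, since it demands a commutative ring.)
\<close>

definition alg_hom ::
  "(complex, 'a) module \<Rightarrow> (complex, 'b) module \<Rightarrow> ('a \<Rightarrow> 'b) set" where
  "alg_hom A B = {h \<in> ring_hom A B.
     \<forall>c. \<forall>x\<in>carrier A. h (c \<odot>\<^bsub>A\<^esub> x) = c \<odot>\<^bsub>B\<^esub> h x}"

definition quotient_alg :: "(complex, 'a) module \<Rightarrow> 'a set \<Rightarrow> (complex, 'a set) module" where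
  "quotient_alg A I =
     \<lparr>carrier = carrier (A Quot I), mult = mult (A Quot I), one = one (A Quot I),
      zero = zero (A Quot I), add = add (A Quot I),
      smult = (\<lambda>c U. \<Union>u\<in>U. I +>\<^bsub>A\<^esub> (c \<odot>\<^bsub>A\<^esub> u))\<rparr>"

definition pm_scale :: "complex \<Rightarrow> ('k \<Rightarrow>\<^sub>0 complex) \<Rightarrow> ('k \<Rightarrow>\<^sub>0 complex)" where
  "pm_scale c p = Poly_Mapping.map ((*) c) p"


section \<open>Free algebras and presentations\<close>

text \<open>
  Words form the free monoid, written additively because the convolution product on
  \<open>\<Rightarrow>\<^sub>0\<close> expects an additive (not necessarily commutative) monoid of exponents.
  So \<open>'g word \<Rightarrow>\<^sub>0 complex\<close> is the free algebra on \<open>'g\<close>.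
\<close>

datatype 'g word = Word "'g list"

instantiation word :: (type) monoid_add
begin

definition zero_word :: "'g word" where
  "zero_word = Word []"

fun plus_word :: "'g word \<Rightarrow> 'g word \<Rightarrow> 'g word" where
  "plus_word (Word xs) (Word ys) = Word (xs @ ys)"

instance
proof
  fix a b c :: "'g word"
  show "a + b + c = a + (b + c)" by (cases a; cases b; cases c) simp
  show "0 + a = a" by (cases a) (simp add: zero_word_def)
  show "a + 0 = a" by (cases a) (simp add: zero_word_def)
qed

end

type_synonym 'g free = "'g word \<Rightarrow>\<^sub>0 complex"

definition gen :: "'g \<Rightarrow> 'g free" where
  "gen g = Poly_Mapping.single (Word [g]) 1"

definition scal :: "complex \<Rightarrow> 'g free" where
  "scal c = Poly_Mapping.single 0 c"

definition free_alg :: "(complex, 'g free) module" where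
  "free_alg = \<lparr>carrier = UNIV, mult = (*), one = 1, zero = 0, add = (+), smult = pm_scale\<rparr>"

lemma ring_free_alg: "ring (free_alg :: (complex, 'g free) module)"
proof (rule ringI)
  show "abelian_group (free_alg :: (complex, 'g free) module)"
  proof (rule abelian_groupI)
    fix x :: "'g free"
    show "\<exists>y\<in>carrier free_alg. y \<oplus>\<^bsub>free_alg\<^esub> x = \<zero>\<^bsub>free_alg\<^esub>"
      by (rule bexI[of _ "- x"]) (simp_all add: free_alg_def)
  qed (simp_all add: free_alg_def algebra_simps)
  show "monoid (free_alg :: (complex, 'g free) module)"
    by unfold_locales (simp_all add: free_alg_def algebra_simps)
qed (simp_all add: free_alg_def algebra_simps)

text \<open>
  \<^const>\<open>genideal\<close> is the two-sided ideal generated by a set. A relation \<open>r = 0\<close> is given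
  by the element \<open>r\<close> of the free algebra.
\<close>

definition presented_alg :: "'g free set \<Rightarrow> (complex, 'g free set) module" where
  "presented_alg rels = quotient_alg free_alg (Idl\<^bsub>free_alg\<^esub> rels)"

definition presented_gen :: "'g free set \<Rightarrow> 'g \<Rightarrow> 'g free set" where
  "presented_gen rels g = (Idl\<^bsub>free_alg\<^esub> rels) +>\<^bsub>free_alg\<^esub> gen g"


section \<open>The algebras of type \<open>D\<^sub>7\<close> and \<open>D\<^sub>8\<close>\<close>

datatype hgen = GT0 | GT1 | GX | GXinv

definition D7_rels :: "complex \<Rightarrow> complex \<Rightarrow> hgen free set" where
  "D7_rels q a =
     (let T0 = gen GT0; T1 = gen GT1; X = gen GX; Xi = gen GXinv in
       {X * Xi - 1, Xi * X - 1,
        T1 * (T1 + 1),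
        T0 ^ 2,
        T1 * X + scal a - Xi * (T1 + 1),
        scal q * T0 * Xi + 1 - X * T0})"

definition D8_rels :: "complex \<Rightarrow> hgen free set" where
  "D8_rels q =
     (let T0 = gen GT0; T1 = gen GT1; X = gen GX; Xi = gen GXinv in
       {X * Xi - 1, Xi * X - 1,
        T1 * (T1 + 1),
        T0 ^ 2,
        T1 * X - Xi * (T1 + 1),
        scal q * T0 * Xi + 1 - X * T0})"


section \<open>Laurent polynomials and the operators\<close>

text \<open>The group algebra of \<open>\<int>\<close>; \<open>lmon c k\<close> is the monomial \<open>c z\<^sup>k\<close>.\<close>

type_synonym laurent = "int \<Rightarrow>\<^sub>0 complex"

definition lmon :: "complex \<Rightarrow> int \<Rightarrow> laurent" where
  "lmon c k = Poly_Mapping.single k c"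

text \<open>\<open>subst_inv c f\<close> is \<open>f[c z\<^sup>-\<^sup>1]\<close>, for \<open>c \<noteq> 0\<close>.\<close>

definition subst_inv :: "complex \<Rightarrow> laurent \<Rightarrow> laurent" where
  "subst_inv c f =
     (\<Sum>k\<in>Poly_Mapping.keys f. lmon (Poly_Mapping.lookup f k * c powi k) (- k))"

definition End_laurent :: "(complex, laurent \<Rightarrow> laurent) module" where
  "End_laurent =
     \<lparr>carrier = {F. Vector_Spaces.linear pm_scale pm_scale F},
      mult = (\<circ>), one = id, zero = (\<lambda>f. 0), add = (\<lambda>F G f. F f + G f),
      smult = (\<lambda>c F f. pm_scale c (F f))\<rparr>"

text \<open>
  The formulas for \<open>T\<^sub>0\<close> and \<open>T\<^sub>1\<close> involve division, so they are evaluated in the fraction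
  field of the Laurent polynomials; that their values are Laurent polynomials again is
  part of the claim in \<open>defines_faithful_rep\<close>.
\<close>

definition emb :: "laurent \<Rightarrow> laurent fract" where
  "emb f = Fract f 1"

definition T0_formula :: "complex \<Rightarrow> laurent \<Rightarrow> laurent fract" where
  "T0_formula q f =
     - (emb (lmon 1 1) / emb (lmon q 0 - lmon 1 2)) * (emb f - emb (subst_inv q f))"

definition T1_formula :: "complex \<Rightarrow> laurent \<Rightarrow> laurent fract" where
  "T1_formula a f =
     (emb (lmon a 1 - lmon 1 0) / emb (lmon 1 0 - lmon 1 2)) * (emb f - emb (subst_inv 1 f))"

definition defines_faithful_rep :: "hgen free set \<Rightarrow> complex \<Rightarrow> complex \<Rightarrow> bool" where
  "defines_faithful_rep rels q a \<longleftrightarrow>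
     (\<exists>T0 T1 :: laurent \<Rightarrow> laurent.
        (\<forall>f. emb (T0 f) = T0_formula q f) \<and>
        (\<forall>f. emb (T1 f) = T1_formula a f) \<and>
        (\<exists>\<phi> \<in> alg_hom (presented_alg rels) End_laurent.
           \<phi> (presented_gen rels GT0) = T0 \<and>
           \<phi> (presented_gen rels GT1) = T1 \<and>
           \<phi> (presented_gen rels GX) = (\<lambda>f. lmon 1 1 * f) \<and>
           \<phi> (presented_gen rels GXinv) = (\<lambda>f. lmon 1 (-1) * f) \<and>
           inj_on \<phi> (carrier (presented_alg rels))))"

end

theory Submission
  imports
    Defs
    "HOL-Analysis.Continuum_Not_Denumerable"
    "HOL-Computational_Algebra.Polynomial"
begin

text \<open>
  For \<open>a = 0\<close> the relations of type \<open>D\<^sub>7\<close> become those of type \<open>D\<^sub>8\<close>, so both parts are one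
  statement, about an arbitrary \<open>a\<close>. That the operators preserve Laurent polynomials is a
  divisibility (\<open>dvd_diff_subst_inv\<close>), and that they satisfy the relations is an identity of
  rational functions (\<open>free_act_rels\<close>). The substance is faithfulness, which follows by playing
  off an upper bound for the algebra against a lower bound for its image.

  Upper bound: the relations allow moving \<open>X\<^sup>\<plusminus>\<^sup>1\<close> to the left of \<open>T\<^sub>0\<close> and \<open>T\<^sub>1\<close> and cancelling
  repeated letters. So the algebra is spanned by the products \<open>X\<^sup>k W\<^sub>m\<close>, where \<open>k\<close> and \<open>m\<close> are
  integers and the \<open>W\<^sub>m\<close> are the alternating words in \<open>T\<^sub>0\<close> and \<open>T\<^sub>1\<close> (\<open>all_reducible\<close>).

  Lower bound: these products act linearly independently (\<open>normal_form_faithful\<close>). Fix a point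
  \<open>z\<close>. The value of \<open>T\<^sub>0 f\<close> at \<open>x\<close> is a multiple of the difference of the values of \<open>f\<close> at \<open>x\<close>
  and \<open>q / x\<close>; for \<open>T\<^sub>1\<close> the second point is \<open>1 / x\<close>. These two involutions generate an infinite
  dihedral group. As \<open>q\<close> is not a root of unity, the orbit of a generic \<open>z\<close> consists of distinct
  points \<open>x\<^sub>j\<close>, indexed by the integers with \<open>x\<^sub>0 = z\<close>, in which the involutions
  alternately exchange neighbours. A word of length \<open>n\<close> hence sees \<open>f\<close> only up to distance \<open>n\<close>,
  and among the points at that distance \<open>W\<^sub>m\<close> sees exactly \<open>x\<^sub>m\<close>, with a nonzero coefficient
  (\<open>leval_alt_word_leading\<close>). Given a vanishing combination of the operators \<open>X\<^sup>k W\<^sub>m\<close>, a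
  Laurent polynomial \<open>f\<close> that vanishes at all nearby orbit points except \<open>x\<^sub>m\<close>, for a longest
  word \<open>W\<^sub>m\<close> in it, isolates the coefficient of this word: a Laurent polynomial in \<open>z\<close> that
  vanishes at infinitely many points, hence identically.
\<close>

section \<open>Linear extension from monomials\<close>

text \<open>
  The coefficient is an argument of the extended function, so that no module structure is
  needed on the target. Evaluation at a point, the action of the free algebra and the
  normal form below are all of this shape.
\<close>

definition lin_ext ::
  "('k \<Rightarrow> 'v::zero \<Rightarrow> 'b::comm_monoid_add) \<Rightarrow> ('k \<Rightarrow>\<^sub>0 'v) \<Rightarrow> 'b" where
  "lin_ext h p = (\<Sum>k\<in>Poly_Mapping.keys p. h k (Poly_Mapping.lookup p k))"

lemma lin_ext_superset:
  assumes "finite A" "Poly_Mapping.keys p \<subseteq> A" "\<And>k. h k 0 = 0"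
  shows "lin_ext h p = (\<Sum>k\<in>A. h k (Poly_Mapping.lookup p k))"
  unfolding lin_ext_def using assms
  by (intro sum.mono_neutral_left) (auto simp: in_keys_iff)

lemma lin_ext_0 [simp]: "lin_ext h 0 = 0"
  by (simp add: lin_ext_def)

lemma lin_ext_single:
  assumes "\<And>k. h k 0 = 0"
  shows "lin_ext h (Poly_Mapping.single k c) = h k c"
  using assms by (simp add: lin_ext_superset[of "{k}"])

lemma lin_ext_add:
  fixes p r :: "'k \<Rightarrow>\<^sub>0 'v::monoid_add"
  assumes "\<And>k. h k 0 = 0" "\<And>k c d. h k (c + d) = h k c + h k d"
  shows "lin_ext h (p + r) = lin_ext h p + lin_ext h r"
proof -
  let ?A = "Poly_Mapping.keys p \<union> Poly_Mapping.keys r"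
  have "Poly_Mapping.keys (p + r) \<subseteq> ?A" by (rule Poly_Mapping.keys_add)
  then show ?thesis
    using assms by (simp add: lin_ext_superset[of ?A] lookup_add sum.distrib)
qed

lemma poly_mapping_monomial_induct [case_names zero single add]:
  fixes p :: "'k \<Rightarrow>\<^sub>0 'v::comm_monoid_add"
  assumes "P 0" "\<And>k c. P (Poly_Mapping.single k c)" "\<And>p r. P p \<Longrightarrow> P r \<Longrightarrow> P (p + r)"
  shows "P p"
proof (induction p rule: update_induct)
  case const
  then show ?case by (rule assms(1))
next
  case (update p k v)
  have "Poly_Mapping.update k v p = p + Poly_Mapping.single k v"
    using update(1) by (intro poly_mapping_eqI)
      (auto simp: lookup_update lookup_add lookup_single in_keys_iff when_def)
  with update assms(2,3) show ?case by simp
qed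

lemma pm_scale_conv_mult: "pm_scale c p = Poly_Mapping.single 0 c * p"
  by (simp add: pm_scale_def mult_map_scale_conv_mult)

lemma lookup_pm_scale [simp]: "Poly_Mapping.lookup (pm_scale c p) k = c * Poly_Mapping.lookup p k"
  unfolding pm_scale_def by (simp add: Poly_Mapping.map.rep_eq when_def)

lemma vector_space_pm_scale: "vector_space (pm_scale :: complex \<Rightarrow> ('k \<Rightarrow>\<^sub>0 complex) \<Rightarrow> _)"
  by unfold_locales (auto intro!: poly_mapping_eqI simp: lookup_add algebra_simps)

section \<open>Laurent polynomials as functions\<close>

definition leval :: "laurent \<Rightarrow> complex \<Rightarrow> complex" where
  "leval f z = lin_ext (\<lambda>k c. c * z powi k) f"

lemma leval_0 [simp]: "leval 0 z = 0"
  by (simp add: leval_def)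

lemma leval_lmon [simp]: "leval (lmon c k) z = c * z powi k"
  by (simp add: leval_def lmon_def lin_ext_single)

lemma leval_1 [simp]: "leval 1 z = 1"
  using leval_lmon[of 1 0 z] by (simp add: lmon_def)

lemma leval_add [simp]: "leval (f + g) z = leval f z + leval g z"
  unfolding leval_def by (rule lin_ext_add) (auto simp: algebra_simps)

lemma leval_uminus [simp]: "leval (- f) z = - leval f z"
  using leval_add[of f "- f" z] by (simp add: add_eq_0_iff)

lemma leval_diff [simp]: "leval (f - g) z = leval f z - leval g z"
  using leval_add[of f "- g" z] by simp

lemma leval_sum: "leval (sum g A) z = (\<Sum>x\<in>A. leval (g x) z)"
  by (induction A rule: infinite_finite_induct) auto

lemma lmon_mult: "lmon c k * lmon d l = lmon (c * d) (k + l)"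
  by (simp add: lmon_def mult_single)

lemma laurent_induct [case_names zero lmon add]:
  assumes "P 0" "\<And>k c. P (lmon c k)" "\<And>f g. P f \<Longrightarrow> P g \<Longrightarrow> P (f + g)"
  shows "P f"
  by (rule poly_mapping_monomial_induct[of P]) (use assms in \<open>auto simp: lmon_def\<close>)

lemma leval_mult [simp]:
  assumes "z \<noteq> 0"
  shows "leval (f * g) z = leval f z * leval g z"
proof (induction f rule: laurent_induct)
  case (lmon k c)
  show ?case
    by (induction g rule: laurent_induct)
      (use assms in \<open>auto simp: lmon_mult power_int_add algebra_simps\<close>)
qed (auto simp: algebra_simps)

lemma leval_prod:
  assumes "z \<noteq> 0"
  shows "leval (prod g A) z = (\<Prod>x\<in>A. leval (g x) z)"
  by (induction A rule: infinite_finite_induct) (use assms in auto)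

lemma leval_pm_scale [simp]: "leval (pm_scale c f) z = c * leval f z"
proof -
  have "Poly_Mapping.keys (pm_scale c f) \<subseteq> Poly_Mapping.keys f"
    by (auto simp: in_keys_iff)
  then show ?thesis
    unfolding leval_def
    by (simp add: lin_ext_superset[of "Poly_Mapping.keys f"] sum_distrib_left mult.assoc)
qed

lemma leval_subst_inv [simp]:
  assumes "c \<noteq> 0" "z \<noteq> 0"
  shows "leval (subst_inv c f) z = leval f (c / z)"
  using assms
  by (simp add: subst_inv_def leval_sum)
    (simp add: leval_def lin_ext_def power_int_divide_distrib power_int_minus field_simps)

text \<open>
  Dividing by the lowest power of \<open>z\<close> turns a Laurent polynomial into a polynomial without
  changing its zeros outside the origin.
\<close>

lemma finite_leval_zeros:
  assumes "f \<noteq> 0"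
  shows "finite {z. z \<noteq> 0 \<and> leval f z = 0}"
proof -
  let ?K = "Poly_Mapping.keys f"
  define m where "m = Min ?K"
  have m: "m \<le> k" if "k \<in> ?K" for k
    using that by (simp add: m_def)
  define p where "p = (\<Sum>k\<in>?K. monom (Poly_Mapping.lookup f k) (nat (k - m)))"
  have ne: "?K \<noteq> {}" using assms by (metis poly_mapping_eqI lookup_zero in_keys_iff ex_in_conv)
  have "coeff p (nat (m - m)) = (\<Sum>k\<in>?K. if k = m then Poly_Mapping.lookup f k else 0)"
    unfolding p_def coeff_sum by (intro sum.cong) (auto simp: nat_eq_iff dest: m)
  also have "\<dots> = Poly_Mapping.lookup f m"
    using ne by (simp add: m_def sum.delta)
  also have "\<dots> \<noteq> 0"
    using ne Min_in[of ?K] by (simp add: m_def in_keys_iff)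
  finally have "p \<noteq> 0" by auto
  moreover have "leval f z = z powi m * poly p z" if "z \<noteq> 0" for z
    unfolding leval_def lin_ext_def p_def poly_sum poly_monom sum_distrib_left
  proof (rule sum.cong[OF refl])
    fix k assume k: "k \<in> ?K"
    have "z powi k = z powi m * z powi (k - m)"
      using that power_int_add[of z m "k - m"] by simp
    also have "\<dots> = z powi m * z ^ nat (k - m)"
      using m[OF k] by (simp add: power_int_def)
    finally show "Poly_Mapping.lookup f k * z powi k
        = z powi m * (Poly_Mapping.lookup f k * z ^ nat (k - m))"
      by simp
  qed
  then have "{z. z \<noteq> 0 \<and> leval f z = 0} \<subseteq> {z. poly p z = 0}" by auto
  ultimately show ?thesis using poly_roots_finite finite_subset by blast
qed

lemma laurent_eq_0I:
  assumes "infinite {z. z \<noteq> 0 \<and> leval f z = 0}"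
  shows "f = 0"
  using assms finite_leval_zeros by blast

text \<open>
  Identities between operators with denominators can therefore be checked at points away
  from the poles, where they are identities between complex numbers.
\<close>

lemma laurent_eqI:
  assumes "finite B" "\<And>z. z \<noteq> 0 \<Longrightarrow> z \<notin> B \<Longrightarrow> leval f z = leval g z"
  shows "f = g"
proof -
  have "UNIV - insert 0 B \<subseteq> {z. z \<noteq> 0 \<and> leval (f - g) z = 0}" using assms(2) by auto
  moreover have "infinite (UNIV - insert 0 B :: complex set)"
    using assms(1) by (simp add: infinite_UNIV_char_0)
  ultimately have "f - g = 0" by (intro laurent_eq_0I) (meson finite_subset)
  then show ?thesis by simp
qed

section \<open>The divided difference operators\<close>

lemma subst_inv_lmon: "subst_inv c (lmon x k) = lmon (x * c powi k) (- k)"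
  by (cases "x = 0") (auto simp: subst_inv_def lmon_def)

lemma subst_inv_add: "subst_inv c (f + g) = subst_inv c f + subst_inv c g"
  using lin_ext_add[of "\<lambda>k x. lmon (x * c powi k) (- k)" f g]
  by (simp add: lin_ext_def subst_inv_def lmon_def single_add algebra_simps)

text \<open>
  On a monomial \<open>z\<^sup>n\<close> this is the divisibility of \<open>u\<^sup>n - v\<^sup>n\<close> by \<open>u - v\<close> for \<open>u = z\<close> and
  \<open>v = c z\<^sup>-\<^sup>1\<close>, because \<open>u - v = - z\<^sup>-\<^sup>1 (c - z\<^sup>2)\<close>; a negative exponent exchanges \<open>u\<close> and \<open>v\<close>
  up to a scalar.
\<close>

lemma dvd_diff_subst_inv:
  assumes "c \<noteq> 0"
  shows "(lmon c 0 - lmon 1 2) dvd (f - subst_inv c f)"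
proof (induction f rule: laurent_induct)
  case zero
  show ?case by (simp add: subst_inv_def)
next
  case (add f g)
  then have "(lmon c 0 - lmon 1 2) dvd ((f - subst_inv c f) + (g - subst_inv c g))"
    by (rule dvd_add)
  then show ?case by (simp add: subst_inv_add algebra_simps)
next
  case (lmon k x)
  have pow: "lmon y j ^ n = lmon (y ^ n) (int n * j)" for y j n
    by (induction n) (simp_all add: lmon_mult algebra_simps, simp add: lmon_def)
  have nonneg: "(lmon c 0 - lmon 1 2) dvd (lmon 1 (int n) - lmon (c ^ n) (- int n))" for n
  proof -
    have "lmon 1 1 - lmon c (- 1) = lmon (- 1) (- 1) * (lmon c 0 - lmon 1 2)"
      by (simp add: right_diff_distrib lmon_mult) (simp add: lmon_def single_uminus)
    then have "(lmon c 0 - lmon 1 2) dvd (lmon 1 1 - lmon c (- 1))" by simp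
    also have "\<dots> dvd (lmon 1 1 ^ n - lmon c (- 1) ^ n)"
      using power_diff_sumr2[of "lmon 1 1" n "lmon c (- 1)"] by simp
    finally show ?thesis by (simp add: pow)
  qed
  show ?case
  proof (cases "k \<ge> 0")
    case True
    then have "lmon x k - subst_inv c (lmon x k)
        = lmon x 0 * (lmon 1 (int (nat k)) - lmon (c ^ nat k) (- int (nat k)))"
      by (simp add: subst_inv_lmon right_diff_distrib lmon_mult power_int_def)
    then show ?thesis using nonneg[of "nat k"] by (metis dvd_mult)
  next
    case False
    then have "lmon x k - subst_inv c (lmon x k)
        = lmon (- x * c powi k) 0 *
          (lmon 1 (int (nat (- k))) - lmon (c ^ nat (- k)) (- int (nat (- k))))"
      using assms
      by (simp add: subst_inv_lmon right_diff_distrib lmon_mult power_int_def field_simps)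
        (simp add: lmon_def single_uminus)
    then show ?thesis using nonneg[of "nat (- k)"] by (metis dvd_mult)
  qed
qed

definition div_diff :: "complex \<Rightarrow> laurent \<Rightarrow> laurent" where
  "div_diff c f = (SOME g. f - subst_inv c f = (lmon c 0 - lmon 1 2) * g)"

lemma div_diff:
  assumes "c \<noteq> 0"
  shows "(lmon c 0 - lmon 1 2) * div_diff c f = f - subst_inv c f"
  unfolding div_diff_def
  using someI_ex[of "\<lambda>g. f - subst_inv c f = (lmon c 0 - lmon 1 2) * g"]
    dvd_diff_subst_inv[OF assms, of f] by (auto simp: dvd_def)

lemma leval_div_diff:
  assumes "c \<noteq> 0" "z \<noteq> 0" "z\<^sup>2 \<noteq> c"
  shows "leval (div_diff c f) z = (leval f z - leval f (c / z)) / (c - z\<^sup>2)"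
proof -
  have "(c - z\<^sup>2) * leval (div_diff c f) z = leval f z - leval f (c / z)"
    using arg_cong[OF div_diff[OF assms(1), of f], of "\<lambda>g. leval g z"] assms by simp
  then show ?thesis using assms by (simp add: field_simps)
qed

fun act :: "complex \<Rightarrow> complex \<Rightarrow> hgen \<Rightarrow> laurent \<Rightarrow> laurent" where
  "act q a GT0 f = - (lmon 1 1 * div_diff q f)"
| "act q a GT1 f = (lmon a 1 - lmon 1 0) * div_diff 1 f"
| "act q a GX f = lmon 1 1 * f"
| "act q a GXinv f = lmon 1 (- 1) * f"

lemma emb_mult: "emb (f * g) = emb f * emb g"
  by (simp add: emb_def)

lemma emb_diff: "emb (f - g) = emb f - emb g"
  by (simp add: emb_def)

lemma emb_div_diff:
  assumes "c \<noteq> 0"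
  shows "emb (div_diff c f) = (emb f - emb (subst_inv c f)) / emb (lmon c 0 - lmon 1 2)"
proof -
  have "leval (lmon c 0 - lmon 1 2) 0 \<noteq> 0" using assms by simp
  then have "lmon c 0 - lmon 1 2 \<noteq> 0" by (metis leval_0)
  then have "emb (lmon c 0 - lmon 1 2) \<noteq> 0" by (simp add: emb_def eq_fract Zero_fract_def)
  then show ?thesis
    unfolding div_diff[OF assms, symmetric] emb_diff[symmetric] by (simp add: emb_mult)
qed

lemma emb_act_T0: "q \<noteq> 0 \<Longrightarrow> emb (act q a GT0 f) = T0_formula q f"
  using emb_diff[of 0 "lmon 1 1 * div_diff q f"]
  by (simp add: emb_mult emb_div_diff T0_formula_def) (simp add: emb_def Zero_fract_def)

lemma emb_act_T1: "emb (act q a GT1 f) = T1_formula a f"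
  by (simp add: emb_mult emb_div_diff T1_formula_def)

lemma leval_act_T0:
  assumes "q \<noteq> 0" "z \<noteq> 0" "z\<^sup>2 \<noteq> q"
  shows "leval (act q a GT0 f) z = - z / (q - z\<^sup>2) * (leval f z - leval f (q / z))"
  using assms by (simp add: leval_div_diff)

lemma leval_act_T1:
  assumes "z \<noteq> 0" "z\<^sup>2 \<noteq> 1"
  shows "leval (act q a GT1 f) z = (a * z - 1) / (1 - z\<^sup>2) * (leval f z - leval f (1 / z))"
  using assms by (simp add: leval_div_diff)

lemma finite_square_roots: "finite {z::complex. z\<^sup>2 = c}"
proof -
  have "{z. z\<^sup>2 = c} \<subseteq> {csqrt c, - csqrt c}"
    using power2_eq_iff[of _ "csqrt c"] by auto
  then show ?thesis using finite_subset by blast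
qed

lemma act_eqI:
  assumes "\<And>z. z \<noteq> 0 \<Longrightarrow> z\<^sup>2 \<noteq> q \<Longrightarrow> z\<^sup>2 \<noteq> 1 \<Longrightarrow> leval f z = leval g z"
  shows "f = g"
  by (rule laurent_eqI[of "{z. z\<^sup>2 = q} \<union> {z. z\<^sup>2 = 1}"])
    (use assms finite_square_roots in auto)

lemma act_add: "q \<noteq> 0 \<Longrightarrow> act q a g (f + h) = act q a g f + act q a g h"
  by (rule act_eqI[of q], cases g)
    (simp_all add: leval_act_T0 leval_act_T1 algebra_simps add_divide_distrib diff_divide_distrib
      del: act.simps(1,2))

lemma act_scale: "q \<noteq> 0 \<Longrightarrow> act q a g (pm_scale c f) = pm_scale c (act q a g f)"
  by (rule act_eqI[of q], cases g)
    (simp_all add: leval_act_T0 leval_act_T1 algebra_simps add_divide_distrib diff_divide_distrib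
      del: act.simps(1,2))

text \<open>
  Both factors of \<open>T\<^sub>0 f\<close>, the rational coefficient and the difference, change sign under
  \<open>z \<mapsto> q / z\<close>. The invariance of their product is what makes \<open>T\<^sub>0\<close> square to zero.
\<close>

lemma leval_act_T0_refl:
  assumes "q \<noteq> 0" "z \<noteq> 0" "z\<^sup>2 \<noteq> q"
  shows "leval (act q a GT0 f) (q / z) = leval (act q a GT0 f) z"
proof -
  have *: "(q / z)\<^sup>2 \<noteq> q" "q / z \<noteq> 0"
    using assms by (auto simp: field_simps power2_eq_square)
  have coeff: "- (q / z) / (q - (q / z)\<^sup>2) = - (- z / (q - z\<^sup>2))"
    using assms * by (simp add: divide_simps power2_eq_square) (simp add: algebra_simps)
  have "leval (act q a GT0 f) (q / z)
      = - (q / z) / (q - (q / z)\<^sup>2) * (leval f (q / z) - leval f (q / (q / z)))"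
    by (rule leval_act_T0[OF assms(1) *(2,1)])
  also have "\<dots> = - z / (q - z\<^sup>2) * (leval f z - leval f (q / z))"
    unfolding coeff using assms(1,2) by (simp add: algebra_simps diff_divide_distrib)
  finally show ?thesis unfolding leval_act_T0[OF assms] .
qed

lemma act_T0_T0: "q \<noteq> 0 \<Longrightarrow> act q a GT0 (act q a GT0 f) = 0"
  by (rule act_eqI[of q]) (simp add: leval_act_T0 leval_act_T0_refl del: act.simps)

lemma act_T1_T1: "act q a GT1 (act q a GT1 f) + act q a GT1 f = 0"
proof (rule act_eqI[of 1])
  fix z :: complex
  assume z: "z \<noteq> 0" "z\<^sup>2 \<noteq> 1"
  then have z': "1 / z \<noteq> 0" "(1 / z)\<^sup>2 \<noteq> 1" by (auto simp: field_simps power2_eq_square)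
  show "leval (act q a GT1 (act q a GT1 f) + act q a GT1 f) z = leval 0 z"
    unfolding leval_add leval_act_T1[OF z] leval_act_T1[OF z']
    using z z' by (simp add: divide_simps power2_eq_square) (simp add: algebra_simps)
qed

lemma act_T1_X:
  "act q a GT1 (act q a GX f) + lmon a 0 * f = act q a GXinv (act q a GT1 f + f)"
proof (rule act_eqI[of 1])
  fix z :: complex
  assume z: "z \<noteq> 0" "z\<^sup>2 \<noteq> 1"
  then show "leval (act q a GT1 (act q a GX f) + lmon a 0 * f) z
      = leval (act q a GXinv (act q a GT1 f + f)) z"
    by (simp add: leval_act_T1 divide_simps power2_eq_square del: act.simps(1,2))
      (simp add: algebra_simps)
qed

lemma act_T0_Xinv:
  assumes "q \<noteq> 0"
  shows "lmon q 0 * act q a GT0 (act q a GXinv f) + f = act q a GX (act q a GT0 f)"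
proof (rule act_eqI[of q])
  fix z :: complex
  assume z: "z \<noteq> 0" "z\<^sup>2 \<noteq> q"
  then show "leval (lmon q 0 * act q a GT0 (act q a GXinv f) + f) z
      = leval (act q a GX (act q a GT0 f)) z"
    using assms
    by (simp add: leval_act_T0 divide_simps power2_eq_square del: act.simps(1,2))
      (simp add: algebra_simps)
qed

section \<open>The free algebra acting on Laurent polynomials\<close>

fun wact :: "complex \<Rightarrow> complex \<Rightarrow> hgen word \<Rightarrow> laurent \<Rightarrow> laurent" where
  "wact q a (Word gs) f = foldr (act q a) gs f"

lemma wact_0 [simp]: "wact q a 0 f = f"
  by (simp add: zero_word_def)

lemma wact_plus: "wact q a (u + v) f = wact q a u (wact q a v f)"
  by (cases u; cases v) simp

lemma wact_add: "q \<noteq> 0 \<Longrightarrow> wact q a w (f + h) = wact q a w f + wact q a w h"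
proof (cases w)
  case (Word gs)
  assume "q \<noteq> 0"
  then have "foldr (act q a) gs (f + h) = foldr (act q a) gs f + foldr (act q a) gs h"
    by (induction gs) (simp_all add: act_add del: act.simps)
  with Word show ?thesis by simp
qed

lemma wact_scale: "q \<noteq> 0 \<Longrightarrow> wact q a w (pm_scale c f) = pm_scale c (wact q a w f)"
proof (cases w)
  case (Word gs)
  assume "q \<noteq> 0"
  then have "foldr (act q a) gs (pm_scale c f) = pm_scale c (foldr (act q a) gs f)"
    by (induction gs) (simp_all add: act_scale del: act.simps)
  with Word show ?thesis by simp
qed

interpretation pm: vector_space "pm_scale :: complex \<Rightarrow> ('k \<Rightarrow>\<^sub>0 complex) \<Rightarrow> _"
  by (rule vector_space_pm_scale)

lemma wact_zero: "q \<noteq> 0 \<Longrightarrow> wact q a w 0 = 0"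
  using wact_scale[of q a w 0 0] by simp

definition free_act :: "complex \<Rightarrow> complex \<Rightarrow> hgen free \<Rightarrow> laurent \<Rightarrow> laurent" where
  "free_act q a P f = lin_ext (\<lambda>w c. pm_scale c (wact q a w f)) P"

lemma free_act_0 [simp]: "free_act q a 0 f = 0"
  by (simp add: free_act_def)

lemma free_act_single [simp]:
  "free_act q a (Poly_Mapping.single w c) f = pm_scale c (wact q a w f)"
  by (simp add: free_act_def lin_ext_single)

lemma free_act_add [simp]: "free_act q a (P + Q) f = free_act q a P f + free_act q a Q f"
  unfolding free_act_def by (rule lin_ext_add) (simp_all add: pm.scale_left_distrib)

lemma free_act_uminus [simp]: "free_act q a (- P) f = - free_act q a P f"
  using free_act_add[of q a P "- P" f] by (simp add: add_eq_0_iff)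

lemma free_act_diff [simp]: "free_act q a (P - Q) f = free_act q a P f - free_act q a Q f"
  using free_act_add[of q a P "- Q" f] by simp

lemma free_act_sum: "free_act q a (sum g A) f = (\<Sum>x\<in>A. free_act q a (g x) f)"
  by (induction A rule: infinite_finite_induct) auto

lemma free_act_gen [simp]: "free_act q a (gen g) f = act q a g f"
  by (simp add: gen_def del: act.simps)

lemma free_act_scal [simp]: "free_act q a (scal c) f = pm_scale c f"
  by (simp add: scal_def)

lemma free_act_1 [simp]: "free_act q a 1 f = f"
  using free_act_scal[of q a 1 f] by (simp add: scal_def)

lemma free_act_plus:
  assumes "q \<noteq> 0"
  shows "free_act q a P (f + h) = free_act q a P f + free_act q a P h"
  by (induction P rule: poly_mapping_monomial_induct)
    (simp_all add: wact_add assms pm.scale_right_distrib algebra_simps)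

lemma free_act_scale:
  assumes "q \<noteq> 0"
  shows "free_act q a P (pm_scale c f) = pm_scale c (free_act q a P f)"
  by (induction P rule: poly_mapping_monomial_induct)
    (simp_all add: wact_scale assms pm.scale_right_distrib mult.commute)

lemma free_act_mult [simp]:
  assumes "q \<noteq> 0"
  shows "free_act q a (P * Q) f = free_act q a P (free_act q a Q f)"
proof (induction P rule: poly_mapping_monomial_induct)
  case (single u c)
  show ?case
    by (induction Q rule: poly_mapping_monomial_induct)
      (use assms in \<open>simp_all add: mult_single wact_plus wact_scale wact_add
        pm.scale_right_distrib algebra_simps free_act_plus del: free_act_single,
        simp_all add: wact_plus wact_scale wact_zero\<close>)
qed (simp_all add: algebra_simps)

lemma free_act_rels:
  assumes "q \<noteq> 0" "r \<in> D7_rels q a"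
  shows "free_act q a r f = 0"
proof -
  have [simp]: "act q a GX (act q a GXinv f) = f" "act q a GXinv (act q a GX f) = f"
    by (simp_all add: mult.assoc[symmetric] lmon_mult) (simp_all add: lmon_def)
  have scale: "lmon c 0 * h = pm_scale c h" for c h by (simp add: lmon_def pm_scale_conv_mult)
  note act_rels = act_T0_T0[OF assms(1), of a f] act_T1_T1[of q a f]
    act_T1_X[of q a f, unfolded scale] act_T0_Xinv[OF assms(1), of a f, unfolded scale]
  from assms(2) show ?thesis
    unfolding D7_rels_def Let_def
    by (elim insertE emptyE; hypsubst)
      (use assms act_rels in \<open>simp_all add: power2_eq_square act_add free_act_plus del: act.simps\<close>)
qed

section \<open>A normal form for the presented algebra\<close>

lemma scal_0 [simp]: "scal 0 = 0" and scal_1: "scal 1 = 1"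
  by (simp_all add: scal_def)

lemma scal_add: "scal (c + d) = scal c + scal d"
  by (simp add: scal_def single_add)

lemma scal_mult: "scal (c * d) = scal c * scal d"
  by (simp add: scal_def mult_single)

text \<open>
  Scalars are central in the free algebra although it is not commutative; this lets the
  noncommutative calculations below collect them on the left.
\<close>

lemma scal_commute: "P * scal c = scal c * P"
  by (induction P rule: poly_mapping_monomial_induct)
    (simp_all add: scal_def mult_single algebra_simps)

lemma scal_left_commute: "P * (scal c * Q) = scal c * (P * Q)"
  by (metis mult.assoc scal_commute)

abbreviation rel_ideal :: "hgen free set \<Rightarrow> hgen free set" where
  "rel_ideal rels \<equiv> Idl\<^bsub>free_alg\<^esub> rels"

lemma rel_ideal_ideal: "ideal (rel_ideal rels) free_alg"
  by (rule ring.genideal_ideal[OF ring_free_alg]) (simp add: free_alg_def)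

lemma rel_ideal_0: "0 \<in> rel_ideal rels"
  using additive_subgroup.zero_closed[OF ideal.axioms(1)[OF rel_ideal_ideal]]
  by (simp add: free_alg_def)

lemma rel_ideal_add: "P \<in> rel_ideal rels \<Longrightarrow> Q \<in> rel_ideal rels \<Longrightarrow> P + Q \<in> rel_ideal rels"
  using additive_subgroup.a_closed[OF ideal.axioms(1)[OF rel_ideal_ideal], of P rels Q]
  by (simp add: free_alg_def)

lemma rel_ideal_left: "P \<in> rel_ideal rels \<Longrightarrow> Q * P \<in> rel_ideal rels"
  using ideal.I_l_closed[OF rel_ideal_ideal, of P rels Q] by (simp add: free_alg_def)

lemma rel_ideal_right: "P \<in> rel_ideal rels \<Longrightarrow> P * Q \<in> rel_ideal rels"
  using ideal.I_r_closed[OF rel_ideal_ideal, of P rels Q] by (simp add: free_alg_def)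

lemma rel_ideal_base: "r \<in> rels \<Longrightarrow> r \<in> rel_ideal rels"
  using ring.genideal_self[OF ring_free_alg, of rels] by (auto simp: free_alg_def)

fun refl_gen :: "bool \<Rightarrow> hgen" where
  "refl_gen True = GT0"
| "refl_gen False = GT1"

fun alt :: "bool \<Rightarrow> nat \<Rightarrow> hgen free" where
  "alt b 0 = 1"
| "alt b (Suc n) = gen (refl_gen b) * alt (\<not> b) n"

text \<open>
  The sign of the index records the first letter: \<open>T\<^sub>0\<close> for positive, \<open>T\<^sub>1\<close> for negative
  indices. With this choice the word of index \<open>m\<close> moves the point of index \<open>0\<close> of an orbit to
  the point of index \<open>m\<close>.
\<close>

definition alt_word :: "int \<Rightarrow> hgen free" where
  "alt_word m = alt (m \<ge> 0) (nat \<bar>m\<bar>)"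

definition xpow :: "int \<Rightarrow> hgen free" where
  "xpow k = (if k \<ge> 0 then gen GX ^ nat k else gen GXinv ^ nat (- k))"

definition normal_form :: "(int \<times> int \<Rightarrow>\<^sub>0 complex) \<Rightarrow> hgen free" where
  "normal_form c = lin_ext (\<lambda>(k, m) x. scal x * xpow k * alt_word m) c"

lemma normal_form_0: "normal_form 0 = 0"
  by (simp add: normal_form_def)

lemma normal_form_single:
  "normal_form (Poly_Mapping.single (k, m) x) = scal x * xpow k * alt_word m"
  unfolding normal_form_def by (subst lin_ext_single) auto

lemma normal_form_add: "normal_form (c + d) = normal_form c + normal_form d"
  unfolding normal_form_def by (rule lin_ext_add) (auto simp: scal_add algebra_simps)

lemma normal_form_scale: "normal_form (pm_scale y c) = scal y * normal_form c"
proof (induction c rule: poly_mapping_monomial_induct)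
  case (single km x)
  then show ?case
    by (cases km) (simp add: pm_scale_def normal_form_single scal_mult mult.assoc)
qed (simp_all add: normal_form_0 normal_form_add pm.scale_right_distrib algebra_simps)

definition reducible :: "hgen free set \<Rightarrow> hgen free set" where
  "reducible rels = {P. \<exists>c. P - normal_form c \<in> rel_ideal rels}"

lemma reducible_add: "P \<in> reducible rels \<Longrightarrow> Q \<in> reducible rels \<Longrightarrow> P + Q \<in> reducible rels"
proof -
  assume "P \<in> reducible rels" "Q \<in> reducible rels"
  then obtain c d where "P - normal_form c \<in> rel_ideal rels" "Q - normal_form d \<in> rel_ideal rels"
    by (auto simp: reducible_def)
  then have "(P - normal_form c) + (Q - normal_form d) \<in> rel_ideal rels" by (rule rel_ideal_add)
  then have "P + Q - normal_form (c + d) \<in> rel_ideal rels"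
    by (simp add: normal_form_add algebra_simps)
  then show ?thesis by (auto simp: reducible_def)
qed

lemma reducible_scal: "P \<in> reducible rels \<Longrightarrow> scal x * P \<in> reducible rels"
proof -
  assume "P \<in> reducible rels"
  then obtain c where "P - normal_form c \<in> rel_ideal rels" by (auto simp: reducible_def)
  then have "scal x * (P - normal_form c) \<in> rel_ideal rels" by (rule rel_ideal_left)
  then have "scal x * P - normal_form (pm_scale x c) \<in> rel_ideal rels"
    by (simp add: normal_form_scale algebra_simps)
  then show ?thesis by (auto simp: reducible_def)
qed

lemma reducible_uminus: "P \<in> reducible rels \<Longrightarrow> - P \<in> reducible rels"
  using reducible_scal[of P rels "- 1"] by (simp add: scal_def single_uminus)

lemma reducible_diff: "P \<in> reducible rels \<Longrightarrow> Q \<in> reducible rels \<Longrightarrow> P - Q \<in> reducible rels"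
  using reducible_add[OF _ reducible_uminus, of P rels Q] by simp

lemma reducible_ideal: "P \<in> rel_ideal rels \<Longrightarrow> P \<in> reducible rels"
  unfolding reducible_def by (rule CollectI, rule exI[of _ 0]) (simp add: normal_form_0)

lemma reducible_cong: "P \<in> reducible rels \<Longrightarrow> Q - P \<in> rel_ideal rels \<Longrightarrow> Q \<in> reducible rels"
  using reducible_add[of P rels "Q - P"] reducible_ideal by simp

lemma reducible_normal_form: "normal_form c \<in> reducible rels"
  unfolding reducible_def by (rule CollectI, rule exI[of _ c]) (simp add: rel_ideal_0)

lemma reducible_alt: "alt b n \<in> reducible rels"
proof -
  have "alt b n = normal_form (Poly_Mapping.single (0, if b then int n else - int n) 1)"
    by (cases n) (auto simp: normal_form_single scal_1 xpow_def alt_word_def nat_add_distrib)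
  then show ?thesis using reducible_normal_form by metis
qed

lemma rel_ideal_X_Xinv:
  "gen GX * gen GXinv - 1 \<in> rel_ideal (D7_rels q a)"
  "gen GXinv * gen GX - 1 \<in> rel_ideal (D7_rels q a)"
  by (auto intro: rel_ideal_base simp: D7_rels_def Let_def)

lemma X_xpow: "gen GX * xpow k - xpow (k + 1) \<in> rel_ideal (D7_rels q a)"
proof (cases "k \<ge> 0")
  case True
  then show ?thesis by (simp add: xpow_def nat_add_distrib rel_ideal_0)
next
  case False
  define n where "n = nat (- 1 - k)"
  have "xpow k = gen GXinv * gen GXinv ^ n"
    using False by (simp add: xpow_def n_def Suc_nat_eq_nat_zadd1 flip: power_Suc)
  moreover have "xpow (k + 1) = gen GXinv ^ n"
    using False by (auto simp: xpow_def n_def algebra_simps)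
  ultimately have "gen GX * xpow k - xpow (k + 1) = (gen GX * gen GXinv - 1) * gen GXinv ^ n"
    by (simp add: algebra_simps)
  then show ?thesis by (simp only: rel_ideal_right rel_ideal_X_Xinv)
qed

lemma Xinv_xpow: "gen GXinv * xpow k - xpow (k - 1) \<in> rel_ideal (D7_rels q a)"
proof (cases "k > 0")
  case False
  then have "xpow (k - 1) = gen GXinv * xpow k"
    by (auto simp: xpow_def nat_diff_distrib simp flip: power_Suc
      intro!: arg_cong[of _ _ "\<lambda>n. gen GXinv ^ n"])
  then show ?thesis by (simp add: rel_ideal_0)
next
  case True
  define n where "n = nat (k - 1)"
  have "xpow k = gen GX * gen GX ^ n"
    using True by (simp add: xpow_def n_def Suc_nat_eq_nat_zadd1 flip: power_Suc)
  moreover have "xpow (k - 1) = gen GX ^ n"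
    using True by (auto simp: xpow_def n_def algebra_simps)
  ultimately have "gen GXinv * xpow k - xpow (k - 1) = (gen GXinv * gen GX - 1) * gen GX ^ n"
    by (simp add: algebra_simps)
  then show ?thesis by (simp only: rel_ideal_right rel_ideal_X_Xinv)
qed

text \<open>
  Left multiplication preserves the ideal and is linear, so stability need only be tested on the
  spanning elements.
\<close>

lemma reducible_mult_left:
  assumes "\<And>k m. P * (xpow k * alt_word m) \<in> reducible rels" "Q \<in> reducible rels"
  shows "P * Q \<in> reducible rels"
proof -
  have "P * normal_form c \<in> reducible rels" for c
  proof (induction c rule: poly_mapping_monomial_induct)
    case zero
    then show ?case by (simp add: normal_form_0 rel_ideal_0 reducible_ideal)
  next
    case (single km x)
    obtain k m where "km = (k, m)" by (cases km)
    then have "P * normal_form (Poly_Mapping.single km x) = scal x * (P * (xpow k * alt_word m))"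
      by (simp add: normal_form_single mult.assoc scal_left_commute)
    then show ?case using assms(1) by (simp add: reducible_scal)
  next
    case (add c d)
    then show ?case by (simp add: normal_form_add distrib_left reducible_add)
  qed
  moreover obtain c where "Q - normal_form c \<in> rel_ideal rels"
    using assms(2) by (auto simp: reducible_def)
  then have "P * Q - P * normal_form c \<in> rel_ideal rels"
    using rel_ideal_left by (simp flip: right_diff_distrib)
  ultimately show ?thesis by (rule reducible_cong)
qed

lemma reducible_xpow_alt: "xpow k * alt_word m \<in> reducible rels"
  using reducible_normal_form[of "Poly_Mapping.single (k, m) 1" rels]
  by (simp add: normal_form_single scal_1)

lemma reducible_X:
  assumes "P \<in> reducible (D7_rels q a)"
  shows "gen GX * P \<in> reducible (D7_rels q a)"
proof (rule reducible_mult_left[OF _ assms])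
  fix k m
  have "(gen GX * xpow k - xpow (k + 1)) * alt_word m \<in> rel_ideal (D7_rels q a)"
    by (rule rel_ideal_right[OF X_xpow])
  then show "gen GX * (xpow k * alt_word m) \<in> reducible (D7_rels q a)"
    using reducible_cong[OF reducible_xpow_alt] by (simp add: algebra_simps)
qed

lemma reducible_Xinv:
  assumes "P \<in> reducible (D7_rels q a)"
  shows "gen GXinv * P \<in> reducible (D7_rels q a)"
proof (rule reducible_mult_left[OF _ assms])
  fix k m
  have "(gen GXinv * xpow k - xpow (k - 1)) * alt_word m \<in> rel_ideal (D7_rels q a)"
    by (rule rel_ideal_right[OF Xinv_xpow])
  then show "gen GXinv * (xpow k * alt_word m) \<in> reducible (D7_rels q a)"
    using reducible_cong[OF reducible_xpow_alt] by (simp add: algebra_simps)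
qed

text \<open>
  The last two relations are rewriting rules that carry \<open>T\<^sub>1\<close> past \<open>X\<close> and \<open>T\<^sub>0\<close> past \<open>X\<^sup>-\<^sup>1\<close>.
  Multiplied by \<open>X\<close> or \<open>X\<^sup>-\<^sup>1\<close> on both sides they also give the two remaining exchanges. As these
  calculations take place in the free algebra, cancelling \<open>X\<close> against \<open>X\<^sup>-\<^sup>1\<close> leaves multiples of
  \<open>u\<close> and \<open>v\<close> behind, which are absorbed by the ideal.
\<close>

lemma reducible_T_X:
  assumes "q \<noteq> 0"
    and R: "R \<in> reducible (D7_rels q a)" "gen (refl_gen b) * R \<in> reducible (D7_rels q a)"
  shows "gen (refl_gen b) * (gen GX * R) \<in> reducible (D7_rels q a)"
    and "gen (refl_gen b) * (gen GXinv * R) \<in> reducible (D7_rels q a)"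
proof -
  let ?I = "rel_ideal (D7_rels q a)" and ?S = "reducible (D7_rels q a)"
  let ?X = "gen GX" and ?Y = "gen GXinv" and ?T = "gen (refl_gen b)"
  define u v where "u = ?X * ?Y - 1" and "v = ?Y * ?X - 1"
  note uv = rel_ideal_X_Xinv[of q a, folded u_def v_def]
  note closed = reducible_add reducible_diff reducible_scal reducible_X reducible_Xinv
    reducible_ideal rel_ideal_left rel_ideal_right uv R
  have "?T * (?X * R) \<in> ?S \<and> ?T * (?Y * R) \<in> ?S"
  proof (cases b)
    case True
    then have T: "?T = gen GT0" by simp
    define r where "r = scal q * ?T * ?Y + 1 - ?X * ?T"
    have r: "r \<in> ?I" unfolding r_def T by (rule rel_ideal_base) (simp add: D7_rels_def Let_def)
    have "?T * (?X * R) = scal q * (?Y * (?T * R)) + R - ?Y * r * (?X * R)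
        + (scal q * (?Y * ?T * v * R) + v * R - v * (?T * (?X * R)))"
      unfolding r_def u_def v_def by (simp add: algebra_simps scal_left_commute)
    also have "\<dots> \<in> ?S" by (intro closed r)
    finally have "?T * (?X * R) \<in> ?S" .
    moreover have "scal q * (?T * (?Y * R)) = r * R - R + ?X * (?T * R)"
      unfolding r_def by (simp add: algebra_simps)
    moreover have "\<dots> \<in> ?S" by (intro closed r)
    ultimately have "scal (inverse q) * (scal q * (?T * (?Y * R))) \<in> ?S"
      by (metis reducible_scal)
    then show ?thesis
      using \<open>?T * (?X * R) \<in> ?S\<close> assms(1)
      by (simp add: mult.assoc[symmetric] flip: scal_mult) (simp add: scal_1 mult.assoc)
  next
    case False
    then have T: "?T = gen GT1" by simp
    define r where "r = ?T * ?X + scal a - ?Y * (?T + 1)"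
    have r: "r \<in> ?I" unfolding r_def T by (rule rel_ideal_base) (simp add: D7_rels_def Let_def)
    have "?T * (?X * R) = r * R - scal a * R + ?Y * (?T * R) + ?Y * R"
      unfolding r_def by (simp add: algebra_simps)
    also have "\<dots> \<in> ?S" by (intro closed r)
    finally have "?T * (?X * R) \<in> ?S" .
    moreover have "?T * (?Y * R) = ?X * (?T * R) + scal a * R - ?Y * R
        + (?X * ?T * u * R + scal a * (u * R) - u * ((?T + 1) * (?Y * R)) - ?X * r * (?Y * R))"
      unfolding r_def u_def v_def by (simp add: algebra_simps scal_left_commute)
    moreover have "\<dots> \<in> ?S" by (intro closed r)
    ultimately show ?thesis by simp
  qed
  then show "?T * (?X * R) \<in> ?S" "?T * (?Y * R) \<in> ?S" by auto
qed

lemma reducible_T_xpow: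
  assumes "q \<noteq> 0"
    and R: "R \<in> reducible (D7_rels q a)" "gen (refl_gen b) * R \<in> reducible (D7_rels q a)"
  shows "xpow k * R \<in> reducible (D7_rels q a) \<and>
    gen (refl_gen b) * (xpow k * R) \<in> reducible (D7_rels q a)"
proof -
  have nat: "gen g ^ n * R \<in> reducible (D7_rels q a) \<and>
    gen (refl_gen b) * (gen g ^ n * R) \<in> reducible (D7_rels q a)" if "g = GX \<or> g = GXinv" for g n
  proof (induction n)
    case 0
    then show ?case using R by simp
  next
    case (Suc n)
    then show ?case
      using that reducible_X reducible_Xinv reducible_T_X[OF assms(1)]
      by (auto simp: mult.assoc)
  qed
  show ?thesis using nat[of GX "nat k"] nat[of GXinv "nat (- k)"] by (simp add: xpow_def)
qed

text \<open>
  Either the new letter prolongs the alternating word, or it repeats the first letter and a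
  quadratic relation applies.
\<close>

lemma reducible_T_alt:
  "gen (refl_gen b) * alt b' n \<in> reducible (D7_rels q a)"
proof (cases "n = 0 \<or> b' = (\<not> b)")
  case True
  then have "gen (refl_gen b) * alt b' n = alt b (Suc n)" by auto
  then show ?thesis using reducible_alt by metis
next
  case False
  then obtain k where n: "n = Suc k" "b' = b" by (cases n) auto
  have quad: "(gen GT0 * gen GT0) * P \<in> rel_ideal (D7_rels q a)"
    "(gen GT1 * (gen GT1 + 1)) * P \<in> rel_ideal (D7_rels q a)" for P
    by (rule rel_ideal_right, rule rel_ideal_base, simp add: D7_rels_def Let_def power2_eq_square)+
  show ?thesis
  proof (cases b)
    case True
    then show ?thesis
      using n reducible_ideal[OF quad(1)] by (simp add: mult.assoc)
  next
    case False
    have "gen (refl_gen b) * alt b' n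
        = (gen GT1 * (gen GT1 + 1)) * alt (\<not> b) k - alt b n"
      using n False by (simp add: algebra_simps)
    then show ?thesis
      using reducible_diff[OF reducible_ideal[OF quad(2)] reducible_alt] by simp
  qed
qed

lemma reducible_gen:
  assumes "q \<noteq> 0" "P \<in> reducible (D7_rels q a)"
  shows "gen g * P \<in> reducible (D7_rels q a)"
proof -
  have "gen (refl_gen b) * P \<in> reducible (D7_rels q a)" for b
    by (rule reducible_mult_left[OF _ assms(2)])
      (simp add: alt_word_def reducible_T_xpow assms(1) reducible_alt reducible_T_alt)
  from this[of True] this[of False] show ?thesis
    using reducible_X[OF assms(2)] reducible_Xinv[OF assms(2)] by (cases g) auto
qed

text \<open>
  A subspace that contains \<open>1\<close> and is stable under left multiplication by the generators is the
  whole algebra.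
\<close>

lemma all_reducible:
  assumes "q \<noteq> 0"
  shows "P \<in> reducible (D7_rels q a)"
proof (induction P rule: poly_mapping_monomial_induct)
  case zero
  then show ?case by (simp add: reducible_ideal rel_ideal_0)
next
  case (single w c)
  obtain gs where "w = Word gs" by (cases w)
  moreover have "Poly_Mapping.single (Word gs) c \<in> reducible (D7_rels q a)"
  proof (induction gs)
    case Nil
    have "Poly_Mapping.single (Word []) c = scal c * alt True 0"
      by (simp add: scal_def zero_word_def)
    then show ?case by (simp only: reducible_scal reducible_alt)
  next
    case (Cons g gs)
    have "Poly_Mapping.single (Word (g # gs)) c = gen g * Poly_Mapping.single (Word gs) c"
      by (simp add: gen_def mult_single)
    then show ?case using reducible_gen[OF assms Cons] by simp
  qed
  ultimately show ?case by simp
next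
  case (add p r)
  then show ?case by (rule reducible_add)
qed

section \<open>Generic orbits of the infinite dihedral group\<close>

text \<open>
  The orbit of \<open>z\<close> under the two involutions \<open>x \<mapsto> q / x\<close> and \<open>x \<mapsto> 1 / x\<close>, laid out on a line so
  that neighbours are exchanged by one of them:
  \<open>\<dots>, q z, 1 / z, z, q / z, z / q, \<dots>\<close> with \<open>z\<close> at index \<open>0\<close>. The first involution joins
  \<open>2 k\<close> to \<open>2 k + 1\<close>, the second one \<open>2 k - 1\<close> to \<open>2 k\<close>.
\<close>

definition orbit :: "complex \<Rightarrow> complex \<Rightarrow> int \<Rightarrow> complex" where
  "orbit q z j = (if even j then z * q powi (- (j div 2)) else q powi ((j + 1) div 2) / z)"

text \<open>
  The conditions on \<open>z\<^sup>2\<close> keep the orbit free of coincidences between even and odd indices and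
  away from the poles \<open>x\<^sup>2 = q\<close> and \<open>x\<^sup>2 = 1\<close> of the operators. The conditions with \<open>a\<close> say that
  the numerator \<open>a x - 1\<close> of \<open>T\<^sub>1\<close> has no zero on the orbit.
\<close>

definition generic :: "complex \<Rightarrow> complex \<Rightarrow> complex \<Rightarrow> bool" where
  "generic q a z \<longleftrightarrow> z \<noteq> 0 \<and>
     (\<forall>k::int. z\<^sup>2 \<noteq> q powi k \<and> a * (z * q powi k) \<noteq> 1 \<and> a * q powi k \<noteq> z)"

text \<open>
  The direction in which an involution moves the point of index \<open>j\<close>; \<open>True\<close> stands for the
  involution belonging to \<open>T\<^sub>0\<close>.
\<close>

definition edge_dir :: "bool \<Rightarrow> int \<Rightarrow> int" where
  "edge_dir b j = (if b = even j then 1 else - 1)"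

text \<open>
  Each of the countably many conditions excludes finitely many points, so
  uncountably many remain.
\<close>

lemma infinite_generic: "infinite {z. generic q a z}"
proof
  assume fin: "finite {z. generic q a z}"
  let ?B = "{0} \<union> (\<Union>k::int. {z. z\<^sup>2 = q powi k} \<union> {inverse (a * q powi k)} \<union> {a * q powi k})"
  have "z = inverse (a * q powi k)" if "a * (z * q powi k) = 1" for z k
    using that inverse_unique[of "a * q powi k" z] by (simp add: mult_ac)
  then have "z \<in> ?B \<union> {z. generic q a z}" for z
    unfolding generic_def by blast
  then have UNIV: "?B \<union> {z. generic q a z} = UNIV" by blast
  have "countable ?B"
    using countable_finite[OF finite_square_roots] by auto
  then have "countable (?B \<union> {z. generic q a z})"
    using countable_finite[OF fin] by (rule countable_Un)
  then show False unfolding UNIV using uncountable_UNIV_complex by blast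
qed

lemma powi_inj:
  fixes q :: complex
  assumes "q \<noteq> 0" "\<forall>m::nat. m \<ge> 1 \<longrightarrow> q ^ m \<noteq> 1" "q powi i = q powi j"
  shows "i = j"
proof -
  have less: False if "i < j" "q powi i = q powi j" for i j :: int
  proof -
    have "q powi (j - i) = 1" using that(2) assms(1) by (simp add: power_int_diff)
    then have "q ^ nat (j - i) = 1" using that(1) by (simp add: power_int_def)
    then show False using assms(2) that(1) by simp
  qed
  show ?thesis using less[of i j] less[of j i] assms(3) by force
qed

lemma orbit_0 [simp]: "orbit q z 0 = z"
  by (simp add: orbit_def)

lemma orbit_refl:
  assumes "q \<noteq> 0" "z \<noteq> 0"
  shows "orbit q z (j + edge_dir b j) = (if b then q else 1) / orbit q z j"
proof -
  obtain k where "j = 2 * k \<or> j = 2 * k + 1" by (metis oddE evenE)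
  then show ?thesis
    using assms
    by (cases b) (auto simp: orbit_def edge_dir_def power_int_minus power_int_add field_simps)
qed

lemma orbit_generic:
  assumes "q \<noteq> 0" "generic q a z"
  shows "orbit q z j \<noteq> 0" "(orbit q z j)\<^sup>2 \<noteq> q powi k" "a * orbit q z j \<noteq> 1"
proof -
  have z: "z \<noteq> 0" "\<And>k::int. z\<^sup>2 \<noteq> q powi k" "\<And>k::int. a * (z * q powi k) \<noteq> 1"
    "\<And>k::int. a * q powi k \<noteq> z"
    using assms(2) by (auto simp: generic_def)
  have sq: "(q powi h)\<^sup>2 = q powi (2 * h)" for h :: int
    using assms(1) power_int_add[of q h h] by (simp add: power2_eq_square)
  show "orbit q z j \<noteq> 0" using z(1) assms(1) by (simp add: orbit_def)
  show "(orbit q z j)\<^sup>2 \<noteq> q powi k"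
  proof (cases "even j")
    case True
    then show ?thesis
      using z(2)[of "k + 2 * (j div 2)"] assms(1)
      by (auto simp: orbit_def power_mult_distrib power_int_add power_int_minus sq
        field_simps)
  next
    case False
    then show ?thesis
      using z(1) z(2)[of "2 * ((j + 1) div 2) - k"] assms(1)
      by (auto simp: orbit_def power_divide power_int_diff sq field_simps)
  qed
  show "a * orbit q z j \<noteq> 1"
    using z(1,3,4) by (auto simp: orbit_def)
qed

text \<open>
  The quotient of two points whose indices have the same parity is a power of \<open>q\<close>, and here \<open>q\<close>
  must not be a root of unity; genericity separates the two parities.
\<close>

lemma orbit_inj:
  assumes q: "q \<noteq> 0" "\<forall>m::nat. m \<ge> 1 \<longrightarrow> q ^ m \<noteq> 1" and "generic q a z"
    and eq: "orbit q z i = orbit q z j"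
  shows "i = j"
proof -
  have z: "z \<noteq> 0" "\<And>k::int. z\<^sup>2 \<noteq> q powi k"
    using assms(3) by (auto simp: generic_def)
  have parity: False if "even i" "odd j" "orbit q z i = orbit q z j" for i j
  proof -
    have "z\<^sup>2 = q powi ((j + 1) div 2 + i div 2)"
      using that z(1) q(1)
      by (simp add: orbit_def power_int_add power_int_minus field_simps power2_eq_square)
    then show False using z(2) by blast
  qed
  show ?thesis
  proof (cases "even i"; cases "even j")
    assume ev: "even i" "even j"
    then have "q powi (- (i div 2)) = q powi (- (j div 2))"
      using eq z(1) by (simp add: orbit_def)
    then have "i div 2 = j div 2" using powi_inj[OF q] by force
    then show ?thesis using ev by (metis dvd_mult_div_cancel)
  next
    assume od: "odd i" "odd j"
    then have "q powi ((i + 1) div 2) = q powi ((j + 1) div 2)"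
      using eq z(1) by (simp add: orbit_def)
    then have "(i + 1) div 2 = (j + 1) div 2" using powi_inj[OF q] by force
    then show ?thesis using od by (auto elim!: oddE)
  qed (use parity eq in \<open>metis+\<close>)
qed

lemma leval_act_orbit:
  assumes "q \<noteq> 0" "generic q a z"
  shows "\<exists>\<beta>. \<beta> \<noteq> 0 \<and> (\<forall>f. leval (act q a (refl_gen b) f) (orbit q z j)
      = \<beta> * (leval f (orbit q z j) - leval f (orbit q z (j + edge_dir b j))))"
proof -
  let ?x = "orbit q z j"
  have z: "z \<noteq> 0" using assms(2) by (simp add: generic_def)
  have x: "?x \<noteq> 0" "?x\<^sup>2 \<noteq> q" "?x\<^sup>2 \<noteq> 1" "a * ?x \<noteq> 1"
    using orbit_generic[OF assms, of j] orbit_generic(2)[OF assms, of j 0]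
      orbit_generic(2)[OF assms, of j 1] by auto
  show ?thesis
  proof (cases b)
    case True
    then show ?thesis
      using x z assms(1)
      by (intro exI[of _ "- ?x / (q - ?x\<^sup>2)"])
        (simp add: leval_act_T0 orbit_refl del: act.simps)
  next
    case False
    then show ?thesis
      using x z assms(1)
      by (intro exI[of _ "(a * ?x - 1) / (1 - ?x\<^sup>2)"])
        (simp add: leval_act_T1 orbit_refl del: act.simps)
  qed
qed

text \<open>
  Every letter either stays at the current point or crosses one edge of the line. A word of length
  \<open>n\<close> gets as far as distance \<open>n\<close> only if all its letters cross, and because the letters
  alternate, they then keep moving in the direction of the first one. If \<open>f\<close> vanishes at all
  points closer than \<open>n\<close>, only this extreme term survives, and its coefficient is a product of
  nonzero numbers.
  
  In the induction step the first letter gives two terms. After crossing, the rest of the word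
  keeps moving in the same direction. After staying, its first letter points the other way, so it
  ends at distance at most \<open>n - 1\<close>, where \<open>f\<close> vanishes.
\<close>

lemma leval_alt_leading:
  assumes "q \<noteq> 0" "generic q a z"
  shows "\<exists>c. c \<noteq> 0 \<and> (\<forall>f. (\<forall>l. \<bar>l\<bar> < int n \<longrightarrow> leval f (orbit q z (j + l)) = 0) \<longrightarrow>
    leval (free_act q a (alt b n) f) (orbit q z j) = c * leval f (orbit q z (j + edge_dir b j * int n)))"
proof (induction n arbitrary: b j)
  case 0
  show ?case by (intro exI[of _ 1]) simp
next
  case (Suc n)
  let ?d = "edge_dir b j"
  have d: "edge_dir (\<not> b) (j + ?d) = ?d" "edge_dir (\<not> b) j = - ?d" "\<bar>?d\<bar> = 1"
    by (auto simp: edge_dir_def)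
  obtain \<beta> where \<beta>: "\<beta> \<noteq> 0" "\<And>f. leval (act q a (refl_gen b) f) (orbit q z j)
      = \<beta> * (leval f (orbit q z j) - leval f (orbit q z (j + ?d)))"
    using leval_act_orbit[OF assms] by blast
  obtain c where c: "c \<noteq> 0" "\<And>f. (\<And>l. \<bar>l\<bar> < int n \<Longrightarrow> leval f (orbit q z (j + ?d + l)) = 0) \<Longrightarrow>
      leval (free_act q a (alt (\<not> b) n) f) (orbit q z (j + ?d))
        = c * leval f (orbit q z (j + ?d + ?d * int n))"
    using Suc.IH[of "j + ?d" "\<not> b"] unfolding d(1) by blast
  obtain c' where c': "\<And>f. (\<And>l. \<bar>l\<bar> < int n \<Longrightarrow> leval f (orbit q z (j + l)) = 0) \<Longrightarrow>
      leval (free_act q a (alt (\<not> b) n) f) (orbit q z j)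
        = c' * leval f (orbit q z (j + - ?d * int n))"
    using Suc.IH[of j "\<not> b"] unfolding d(2) by blast
  show ?case
  proof (intro exI[of _ "- \<beta> * c"] conjI allI impI)
    show "- \<beta> * c \<noteq> 0" using \<beta>(1) c(1) by simp
    fix f assume *: "\<forall>l. \<bar>l\<bar> < int (Suc n) \<longrightarrow> leval f (orbit q z (j + l)) = 0"
    have dn: "\<bar>- ?d * int n\<bar> < int (Suc n)" using d(3) by (simp add: abs_mult)
    have "leval (free_act q a (alt (\<not> b) n) f) (orbit q z j) = 0"
      using c'[of f] *[rule_format, OF dn] * by simp
    moreover have "leval f (orbit q z (j + ?d + l)) = 0" if "\<bar>l\<bar> < int n" for l
      using *[rule_format, of "?d + l"] that d(3) by (simp add: add.assoc)
    then have "leval (free_act q a (alt (\<not> b) n) f) (orbit q z (j + ?d))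
        = c * leval f (orbit q z (j + ?d + ?d * int n))"
      by (rule c(2))
    ultimately show "leval (free_act q a (alt b (Suc n)) f) (orbit q z j)
        = - \<beta> * c * leval f (orbit q z (j + ?d * int (Suc n)))"
      using assms(1) by (simp add: \<beta>(2) algebra_simps del: act.simps)
  qed
qed

lemma leval_alt_word_leading:
  assumes "q \<noteq> 0" "generic q a z"
  obtains c where "c \<noteq> 0"
    "\<And>f. (\<And>l. \<bar>l\<bar> < \<bar>m\<bar> \<Longrightarrow> leval f (orbit q z l) = 0) \<Longrightarrow>
      leval (free_act q a (alt_word m) f) z = c * leval f (orbit q z m)"
proof -
  have *: "edge_dir (m \<ge> 0) 0 * int (nat \<bar>m\<bar>) = m" by (simp add: edge_dir_def)
  then show ?thesis
    using leval_alt_leading[OF assms, of "nat \<bar>m\<bar>" 0 "m \<ge> 0"] that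
    unfolding alt_word_def by (auto simp: *)
qed

lemma orbit_separating:
  assumes q: "q \<noteq> 0" "\<forall>m::nat. m \<ge> 1 \<longrightarrow> q ^ m \<noteq> 1" and "generic q a z"
  obtains f where "leval f (orbit q z m) \<noteq> 0"
    "\<And>l. \<bar>l\<bar> \<le> n \<Longrightarrow> l \<noteq> m \<Longrightarrow> leval f (orbit q z l) = 0"
proof
  \<comment> \<open>the numerator of a Lagrange basis polynomial for the points of the orbit\<close>
  let ?f = "\<Prod>i\<in>{- n..n} - {m}. lmon 1 1 - lmon (orbit q z i) 0"
  have val: "leval ?f (orbit q z l) = (\<Prod>i\<in>{- n..n} - {m}. orbit q z l - orbit q z i)" for l
    using orbit_generic(1)[OF q(1) assms(3)] by (simp add: leval_prod)
  show "leval ?f (orbit q z m) \<noteq> 0"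
    unfolding val using orbit_inj[OF q assms(3)] by auto
  show "leval ?f (orbit q z l) = 0" if "\<bar>l\<bar> \<le> n" "l \<noteq> m" for l
    unfolding val using that by (auto intro!: bexI[of _ l])
qed

lemma free_act_xpow: "q \<noteq> 0 \<Longrightarrow> free_act q a (xpow k) f = lmon 1 k * f"
proof -
  assume q: "q \<noteq> 0"
  have "free_act q a (gen GX ^ n) f = lmon 1 (int n) * f"
    "free_act q a (gen GXinv ^ n) f = lmon 1 (- int n) * f" for n
    by (induction n) (use q in \<open>simp_all add: mult.assoc[symmetric] lmon_mult\<close>,
        simp_all add: lmon_def)
  then show ?thesis by (simp add: xpow_def)
qed

lemma leval_free_act_normal_form:
  assumes "q \<noteq> 0" "z \<noteq> 0"
  shows "leval (free_act q a (normal_form c) f) z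
    = (\<Sum>(k, m)\<in>Poly_Mapping.keys c. Poly_Mapping.lookup c (k, m) * z powi k *
        leval (free_act q a (alt_word m) f) z)"
  unfolding normal_form_def lin_ext_def free_act_sum leval_sum
  by (rule sum.cong) (use assms in \<open>auto simp: free_act_xpow\<close>)

text \<open>
  Among the words that occur, take one of maximal length, with index \<open>m0\<close>, and for each generic \<open>z\<close>
  a Laurent polynomial \<open>f\<close> supported at \<open>m0\<close> among the orbit points of index up to that length.
  By the leading term lemma all other words send \<open>f\<close> to a function that vanishes at \<open>z\<close>. What
  remains is the coefficient of the word \<open>m0\<close>, a Laurent polynomial \<open>g\<close> that does not depend on
  \<open>f\<close>, evaluated at \<open>z\<close> and multiplied by a nonzero number. So \<open>g\<close> has infinitely many zeros.
\<close>

lemma normal_form_faithful: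
  assumes q: "q \<noteq> 0" "\<forall>m::nat. m \<ge> 1 \<longrightarrow> q ^ m \<noteq> 1"
    and zero: "\<And>f. free_act q a (normal_form c) f = 0"
  shows "c = 0"
proof (rule ccontr)
  assume "c \<noteq> 0"
  let ?K = "Poly_Mapping.keys c"
  have ne: "?K \<noteq> {}"
    using \<open>c \<noteq> 0\<close> by (metis poly_mapping_eqI lookup_zero in_keys_iff ex_in_conv)
  define n where "n = Max ((\<lambda>km. \<bar>snd km\<bar>) ` ?K)"
  have "n \<in> (\<lambda>km. \<bar>snd km\<bar>) ` ?K" unfolding n_def using ne by (intro Max_in) auto
  then obtain k0 m0 where km0: "(k0, m0) \<in> ?K" "\<bar>m0\<bar> = n" by auto
  have n: "\<bar>m\<bar> \<le> n" if "(k, m) \<in> ?K" for k m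
    unfolding n_def using that by (intro Max_ge) force+
  define L where "L = {km \<in> ?K. snd km = m0}"
  define g where "g = (\<Sum>km\<in>L. lmon (Poly_Mapping.lookup c km) (fst km))"
  have "leval g z = 0" if z: "generic q a z" for z
  proof -
    obtain f where f: "leval f (orbit q z m0) \<noteq> 0"
      "\<And>l. \<bar>l\<bar> \<le> n \<Longrightarrow> l \<noteq> m0 \<Longrightarrow> leval f (orbit q z l) = 0"
      using orbit_separating[OF q z] by blast
    have lead: "\<exists>d. d \<noteq> 0 \<and> leval (free_act q a (alt_word m) f) z = d * leval f (orbit q z m)"
      if "\<bar>m\<bar> \<le> n" for m
    proof -
      have "leval f (orbit q z l) = 0" if "\<bar>l\<bar> < \<bar>m\<bar>" for l
        using f(2)[of l] that \<open>\<bar>m\<bar> \<le> n\<close> km0(2) by auto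
      then show ?thesis using leval_alt_word_leading[OF q(1) z, of m] by metis
    qed
    define \<kappa> where "\<kappa> = leval (free_act q a (alt_word m0) f) z"
    have "\<kappa> \<noteq> 0" using lead[of m0] f(1) km0(2) by (auto simp: \<kappa>_def)
    have other: "leval (free_act q a (alt_word m) f) z = 0" if "(k, m) \<in> ?K" "m \<noteq> m0" for k m
      using lead[of m] f(2)[of m] n[OF that(1)] that(2) by auto
    have z0: "z \<noteq> 0" using z by (simp add: generic_def)
    have "0 = (\<Sum>(k, m)\<in>?K. Poly_Mapping.lookup c (k, m) * z powi k *
        leval (free_act q a (alt_word m) f) z)"
      using leval_free_act_normal_form[OF q(1) z0, of a c f] zero[of f] by simp
    also have "\<dots> = (\<Sum>(k, m)\<in>L. Poly_Mapping.lookup c (k, m) * z powi k *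
        leval (free_act q a (alt_word m) f) z)"
    proof (intro sum.mono_neutral_right ballI)
      fix km assume "km \<in> ?K - L"
      then show "(case km of (k, m) \<Rightarrow> Poly_Mapping.lookup c (k, m) * z powi k *
          leval (free_act q a (alt_word m) f) z) = 0"
        using other[of "fst km" "snd km"] by (simp add: L_def split_beta)
    qed (auto simp: L_def)
    also have "\<dots> = leval g z * \<kappa>"
      unfolding g_def leval_sum sum_distrib_right
      by (rule sum.cong) (auto simp: L_def \<kappa>_def)
    finally show ?thesis using \<open>\<kappa> \<noteq> 0\<close> by simp
  qed
  then have "{z. generic q a z} \<subseteq> {z. z \<noteq> 0 \<and> leval g z = 0}"
    by (auto simp: generic_def)
  then have "g = 0"
    using infinite_generic laurent_eq_0I by (meson finite_subset)
  moreover have "Poly_Mapping.lookup g k0 = Poly_Mapping.lookup c (k0, m0)"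
  proof -
    have "Poly_Mapping.lookup g k0
        = (\<Sum>km\<in>L. if km = (k0, m0) then Poly_Mapping.lookup c km else 0)"
      unfolding g_def lookup_sum
      by (rule sum.cong) (auto simp: L_def lmon_def lookup_single)
    also have "\<dots> = Poly_Mapping.lookup c (k0, m0)"
      using km0(1) by (simp add: L_def)
    finally show ?thesis .
  qed
  ultimately show False using km0(1) by (simp add: in_keys_iff)
qed

section \<open>Passing to the quotient\<close>

lemma linear_laurent_iff:
  "Vector_Spaces.linear pm_scale pm_scale (F :: laurent \<Rightarrow> laurent) \<longleftrightarrow>
    (\<forall>f g. F (f + g) = F f + F g) \<and> (\<forall>c f. F (pm_scale c f) = pm_scale c (F f))"
  using pm.vector_space_axioms pm.module_axioms
  by (auto simp: Vector_Spaces.linear_def module_hom_def module_hom_axioms_def)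

lemma ring_End_laurent: "ring End_laurent"
proof (rule ringI)
  show "abelian_group End_laurent"
  proof (rule abelian_groupI)
    fix F assume "F \<in> carrier End_laurent"
    then show "\<exists>G\<in>carrier End_laurent. G \<oplus>\<^bsub>End_laurent\<^esub> F = \<zero>\<^bsub>End_laurent\<^esub>"
      by (intro bexI[of _ "\<lambda>f. - F f"])
        (auto simp: End_laurent_def linear_laurent_iff pm.scale_minus_right)
  qed (auto simp: End_laurent_def linear_laurent_iff pm.scale_right_distrib algebra_simps)
  show "monoid End_laurent"
    by unfold_locales (auto simp: End_laurent_def linear_laurent_iff)
qed (auto simp: End_laurent_def linear_laurent_iff fun_eq_iff)

lemma ring_hom_free_act:
  assumes "q \<noteq> 0"
  shows "ring_hom_ring free_alg End_laurent (free_act q a)"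
  by (rule ring_hom_ringI[OF ring_free_alg ring_End_laurent])
    (use assms in \<open>auto simp: free_alg_def End_laurent_def linear_laurent_iff fun_eq_iff
      free_act_plus free_act_scale\<close>)

text \<open>
  An element of the kernel is congruent to a normal form that acts as zero, and the only such normal
  form is zero.
\<close>

lemma kernel_free_act:
  assumes q: "q \<noteq> 0" "\<forall>m::nat. m \<ge> 1 \<longrightarrow> q ^ m \<noteq> 1"
  shows "a_kernel free_alg End_laurent (free_act q a) = rel_ideal (D7_rels q a)"
proof -
  let ?ker = "a_kernel free_alg End_laurent (free_act q a)"
  have ker: "P \<in> ?ker \<longleftrightarrow> (\<forall>f. free_act q a P f = 0)" for P
    by (auto simp: a_kernel_def' free_alg_def End_laurent_def fun_eq_iff)
  have sub: "rel_ideal (D7_rels q a) \<subseteq> ?ker"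
    by (rule ring.genideal_minimal[OF ring_free_alg
          ring_hom_ring.kernel_is_ideal[OF ring_hom_free_act[OF q(1)]]])
      (auto simp: ker free_act_rels[OF q(1)])
  moreover have "P \<in> rel_ideal (D7_rels q a)" if P: "P \<in> ?ker" for P
  proof -
    obtain c where c: "P - normal_form c \<in> rel_ideal (D7_rels q a)"
      using all_reducible[OF q(1), of P a] by (auto simp: reducible_def)
    then have "P - normal_form c \<in> ?ker" using sub by blast
    with P have "free_act q a (normal_form c) f = 0" for f by (auto simp: ker)
    then have "c = 0" using normal_form_faithful[OF q] by blast
    with c show ?thesis by (simp add: normal_form_0)
  qed
  ultimately show ?thesis by blast
qed

lemma presented_alg_carrierE:
  assumes "U \<in> carrier (presented_alg rels)"
  obtains P where "U = rel_ideal rels +>\<^bsub>free_alg\<^esub> P"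
  using assms by (auto simp: presented_alg_def quotient_alg_def FactRing_def A_RCOSETS_def')

lemma coset_eq: "rel_ideal rels +>\<^bsub>free_alg\<^esub> P = {i + P | i. i \<in> rel_ideal rels}"
  by (auto simp: a_r_coset_def' free_alg_def)

lemma presented_smult_coset:
  "c \<odot>\<^bsub>presented_alg rels\<^esub> (rel_ideal rels +>\<^bsub>free_alg\<^esub> P)
    = rel_ideal rels +>\<^bsub>free_alg\<^esub> (scal c * P)" (is "?L = ?R")
proof
  let ?I = "rel_ideal rels"
  have L: "?L = {i + scal c * (j + P) | i j. i \<in> ?I \<and> j \<in> ?I}"
    unfolding presented_alg_def quotient_alg_def module.simps coset_eq
    by (auto simp: free_alg_def pm_scale_conv_mult scal_def)
  show "?L \<subseteq> ?R"
  proof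
    fix x assume "x \<in> ?L"
    then obtain i j where ij: "i \<in> ?I" "j \<in> ?I" and "x = i + scal c * (j + P)"
      unfolding L by blast
    then have "x = (i + scal c * j) + scal c * P" by (simp add: distrib_left add.assoc)
    then show "x \<in> ?R"
      unfolding coset_eq using rel_ideal_add[OF ij(1) rel_ideal_left[OF ij(2)]] by blast
  qed
  show "?R \<subseteq> ?L"
  proof
    fix x assume "x \<in> ?R"
    then obtain i where "i \<in> ?I" "x = i + scal c * (0 + P)"
      unfolding coset_eq by auto
    then show "x \<in> ?L" unfolding L using rel_ideal_0 by blast
  qed
qed

lemma free_act_smult:
  "q \<noteq> 0 \<Longrightarrow> free_act q a (scal c * P) = c \<odot>\<^bsub>End_laurent\<^esub> free_act q a P"
  by (rule ext) (simp add: End_laurent_def)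

text \<open>
  Part (ii) is therefore the case \<open>a = 0\<close> of a statement about the algebras of type \<open>D\<^sub>7\<close> that
  holds for every \<open>a\<close>.
\<close>

lemma D8_rels_eq: "D8_rels q = D7_rels q 0"
  by (simp add: D8_rels_def D7_rels_def)

lemma defines_faithful_rep_D7:
  assumes q: "q \<noteq> 0" "\<forall>m::nat. m \<ge> 1 \<longrightarrow> q ^ m \<noteq> 1"
  shows "defines_faithful_rep (D7_rels q a) q a"
proof -
  let ?h = "free_act q a" and ?I = "rel_ideal (D7_rels q a)"
    and ?A = "presented_alg (D7_rels q a)"
  interpret ring_hom_ring free_alg End_laurent ?h by (rule ring_hom_free_act[OF q(1)])
  note ker = kernel_free_act[OF q, of a]
  define \<phi> where "\<phi> = (\<lambda>U. the_elem (?h ` U))"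
  have coset: "\<phi> (?I +>\<^bsub>free_alg\<^esub> P) = ?h P" for P
    using the_elem_simp[of P] by (simp add: \<phi>_def ker) (simp add: free_alg_def)
  have ring_hom: "\<phi> \<in> ring_hom ?A End_laurent"
    using the_elem_hom unfolding ker \<phi>_def[symmetric]
    by (simp add: ring_hom_def presented_alg_def quotient_alg_def)
  have scale: "\<phi> (c \<odot>\<^bsub>?A\<^esub> U) = c \<odot>\<^bsub>End_laurent\<^esub> \<phi> U" if carr: "U \<in> carrier ?A" for c U
  proof -
    obtain P where P: "U = ?I +>\<^bsub>free_alg\<^esub> P"
      using carr by (rule presented_alg_carrierE)
    show ?thesis
      unfolding P presented_smult_coset coset by (rule free_act_smult[OF q(1)])
  qed
  have "\<phi> \<in> alg_hom ?A End_laurent"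
    using ring_hom scale by (auto simp: alg_hom_def)
  moreover have gen: "\<phi> (presented_gen (D7_rels q a) g) = act q a g" for g
    by (simp add: presented_gen_def coset fun_eq_iff del: act.simps)
  moreover have "inj_on \<phi> (carrier ?A)"
    using the_elem_inj unfolding ker by (auto simp: inj_on_def \<phi>_def presented_alg_def quotient_alg_def)
  ultimately show ?thesis
    unfolding defines_faithful_rep_def
    by (intro exI[of _ "act q a GT0"] exI[of _ "act q a GT1"] conjI allI bexI[of _ \<phi>])
      (auto simp: emb_act_T0[OF q(1)] emb_act_T1 fun_eq_iff simp del: act.simps(1,2))
qed

theorem theorem4p2:
  fixes q a :: complex
  assumes "q \<noteq> 0"
    and "\<And>m::nat. m \<ge> 1 \<Longrightarrow> q ^ m \<noteq> 1"
  shows "(a \<noteq> 0 \<longrightarrow> defines_faithful_rep (D7_rels q a) q a) \<and>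
         (a = 0 \<longrightarrow> defines_faithful_rep (D8_rels q) q a)"
proof -
  have "defines_faithful_rep (D7_rels q a) q a"
    by (rule defines_faithful_rep_D7) (use assms in auto)
  then show ?thesis by (auto simp: D8_rels_eq)
qed

end
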